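(* Let $\mathcal{H}$ be a separable Hilbert space, $K\in B(\mathcal{H})$, and let $\{\theta_i\}_{i\in I}$ be an $l^2$-resolution of $K$ with respect to a family of weights $\{\omega_i\}_{i\in I}$ for $\mathcal{H}$, such that $W=\{(\overline{R(\theta_i)},\omega_i)\}_{i\in I}$ is a Bessel fusion sequence. Then $W$ is a $K$-fusion frame for $\mathcal{H}$.
   Context: $I$ is a countable index set; weights are numbers $\omega_i>0$; $R(\theta)$ is the range of $\theta$; $\pi_V$ is the orthogonal projection onto a closed subspace $V$. A family $\{\theta_i\}_{i\in I}$ of bounded linear operators on $\mathcal{H}$ is an $l^2$-resolution of $K$ with respect to $\{\omega_i\}_{i\in I}$ if there is a constant $B>0$ such that for every $f\in\mathcal{H}$: (i) $Kf=\sum_{i\in I}\omega_i^2\theta_if$, and (ii) $\sum_{i\in I}\omega_i^2\|\theta_if\|^2\le B\|f\|^2$. A family $\{(W_i,\omega_i)\}_{i\in I}$ of closed subspaces with weights is a Bessel fusion sequence if there is $B<\infty$ with $\sum_i\omega_i^2\|\pi_{W_i}f\|^2\le B\|f\|^2$ for all $f\in\mathcal{H}$, and a $K$-fusion frame if moreover there is $A>0$ with $A\|K^*f\|^2\le\sum_i\omega_i^2\|\pi_{W_i}f\|^2$ for all $f\in\mathcal{H}$. *)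

theory Defs
  imports "HOL-Analysis.Analysis"
begin

text \<open>
  Hilbert spaces are treated over the real and the complex numbers at the same time.  The class
  below describes the admissible scalar fields.  Since \<open>z + sconj z\<close> and \<open>z * sconj z\<close>
  are real scalars, every element is a root of a real quadratic polynomial, so up to isomorphism
  the only instances are \<^typ>\<open>real\<close> and \<^typ>\<open>complex\<close>.
\<close>

class real_or_complex = real_normed_field +
  fixes sconj :: "'a \<Rightarrow> 'a"
  assumes sconj_add: "sconj (x + y) = sconj x + sconj y"
    and sconj_mult: "sconj (x * y) = sconj x * sconj y"
    and sconj_sconj: "sconj (sconj x) = x"
    and mult_sconj: "x * sconj x = (norm x)\<^sup>2 *\<^sub>R 1"

instantiation real :: real_or_complex
begin
definition sconj_real :: "real \<Rightarrow> real" where "sconj_real x = x"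
instance by standard (simp_all add: sconj_real_def power2_eq_square)
end

instantiation complex :: real_or_complex
begin
definition sconj_complex :: "complex \<Rightarrow> complex" where "sconj_complex = cnj"
instance by standard
    (simp_all add: sconj_complex_def complex_norm_square scaleR_conv_of_real del: of_real_power)
end

text \<open>
  Completeness and the norm topology come from the sort \<^class>\<open>banach\<close>.  The inner product
  is linear in its first argument.
\<close>

locale hilbert_space = vector_space smul
  for smul :: "'k::real_or_complex \<Rightarrow> 'a::banach \<Rightarrow> 'a" +
  fixes ip :: "'a \<Rightarrow> 'a \<Rightarrow> 'k"
  assumes smul_of_real: "smul (of_real r) x = r *\<^sub>R x"
    and ip_add_left: "ip (x + y) z = ip x z + ip y z"
    and ip_smul_left: "ip (smul c x) y = c * ip x y"
    and ip_commute: "ip y x = sconj (ip x y)"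
    and ip_self: "ip x x = of_real ((norm x)\<^sup>2)"

lemma hilbert_space_real_inner:
  "hilbert_space (\<lambda>r x::'a::{real_inner,banach}. r *\<^sub>R x) inner"
  by unfold_locales
    (simp_all add: scaleR_right_distrib scaleR_left_distrib inner_add_left inner_add_right sconj_real_def
      inner_commute power2_norm_eq_inner)

lemma hilbert_space_complex: "hilbert_space (*) (\<lambda>x y::complex. x * cnj y)"
  by unfold_locales
    (simp_all add: algebra_simps scaleR_conv_of_real sconj_complex_def complex_norm_square
      del: of_real_power)

text \<open>The condition \<^term>\<open>bounded_linear T\<close> only gives linearity over the reals.\<close>

definition bounded_operator ::
  "('k::real_or_complex \<Rightarrow> 'a::banach \<Rightarrow> 'a) \<Rightarrow> ('a \<Rightarrow> 'a) \<Rightarrow> bool" where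
  "bounded_operator smul T \<longleftrightarrow>
     bounded_linear T \<and> (\<forall>c x. T (smul c x) = smul c (T x))"

definition hilbert_adjoint ::
  "('a::banach \<Rightarrow> 'a \<Rightarrow> 'k::real_or_complex) \<Rightarrow> ('a \<Rightarrow> 'a) \<Rightarrow> 'a \<Rightarrow> 'a" where
  "hilbert_adjoint ip T = (THE T'. \<forall>x y. ip (T x) y = ip x (T' y))"

definition closed_subspace ::
  "('k::real_or_complex \<Rightarrow> 'a::banach \<Rightarrow> 'a) \<Rightarrow> 'a set \<Rightarrow> bool" where
  "closed_subspace smul V \<longleftrightarrow> module.subspace smul V \<and> closed V"

definition orth_proj ::
  "('a::banach \<Rightarrow> 'a \<Rightarrow> 'k::real_or_complex) \<Rightarrow> 'a set \<Rightarrow> 'a \<Rightarrow> 'a" where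
  "orth_proj ip V f = (THE p. p \<in> V \<and> (\<forall>v\<in>V. ip (f - p) v = 0))"

text \<open>
  A series over the (unordered) index set is an unconditional sum; a bound on a series of
  nonnegative reals includes its convergence.
\<close>

definition l2_resolution ::
  "('k::real_or_complex \<Rightarrow> 'a::banach \<Rightarrow> 'a) \<Rightarrow> 'i set \<Rightarrow>
   ('a \<Rightarrow> 'a) \<Rightarrow> ('i \<Rightarrow> 'a \<Rightarrow> 'a) \<Rightarrow> ('i \<Rightarrow> real) \<Rightarrow> bool" where
  "l2_resolution smul I K \<theta> \<omega> \<longleftrightarrow>
     (\<forall>i\<in>I. bounded_operator smul (\<theta> i)) \<and> (\<forall>i\<in>I. \<omega> i > 0) \<and>
     (\<exists>B>0. \<forall>f.
        ((\<lambda>i. (\<omega> i)\<^sup>2 *\<^sub>R \<theta> i f) has_sum K f) I \<and>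
        (\<lambda>i. (\<omega> i)\<^sup>2 * (norm (\<theta> i f))\<^sup>2) summable_on I \<and>
        (\<Sum>\<^sub>\<infinity>i\<in>I. (\<omega> i)\<^sup>2 * (norm (\<theta> i f))\<^sup>2) \<le> B * (norm f)\<^sup>2)"

definition bessel_fusion_sequence ::
  "('k::real_or_complex \<Rightarrow> 'a::banach \<Rightarrow> 'a) \<Rightarrow> ('a \<Rightarrow> 'a \<Rightarrow> 'k) \<Rightarrow> 'i set \<Rightarrow>
   ('i \<Rightarrow> 'a set) \<Rightarrow> ('i \<Rightarrow> real) \<Rightarrow> bool" where
  "bessel_fusion_sequence smul ip I W \<omega> \<longleftrightarrow>
     (\<forall>i\<in>I. closed_subspace smul (W i)) \<and> (\<forall>i\<in>I. \<omega> i > 0) \<and>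
     (\<exists>B. \<forall>f.
        (\<lambda>i. (\<omega> i)\<^sup>2 * (norm (orth_proj ip (W i) f))\<^sup>2) summable_on I \<and>
        (\<Sum>\<^sub>\<infinity>i\<in>I. (\<omega> i)\<^sup>2 * (norm (orth_proj ip (W i) f))\<^sup>2) \<le> B * (norm f)\<^sup>2)"

definition K_fusion_frame ::
  "('k::real_or_complex \<Rightarrow> 'a::banach \<Rightarrow> 'a) \<Rightarrow> ('a \<Rightarrow> 'a \<Rightarrow> 'k) \<Rightarrow> 'i set \<Rightarrow>
   ('a \<Rightarrow> 'a) \<Rightarrow> ('i \<Rightarrow> 'a set) \<Rightarrow> ('i \<Rightarrow> real) \<Rightarrow> bool" where
  "K_fusion_frame smul ip I K W \<omega> \<longleftrightarrow>
     bessel_fusion_sequence smul ip I W \<omega> \<and>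
     (\<exists>A>0. \<forall>f. A * (norm (hilbert_adjoint ip K f))\<^sup>2 \<le>
        (\<Sum>\<^sub>\<infinity>i\<in>I. (\<omega> i)\<^sup>2 * (norm (orth_proj ip (W i) f))\<^sup>2))"

end

theory Submission
  imports Defs
begin

text \<open>
  For \<open>g = K\<^sup>* f\<close> one has \<open>\<parallel>g\<parallel>\<^sup>2 = \<langle>g, K\<^sup>* f\<rangle> = \<langle>K g, f\<rangle> = \<Sum>\<omega>\<^sub>i\<^sup>2 \<langle>\<theta>\<^sub>i g, f\<rangle>\<close> by the
  reconstruction formula.  Since \<open>\<theta>\<^sub>i g\<close> lies in the \<open>i\<close>-th subspace, \<open>f\<close> may be replaced in the
  \<open>i\<close>-th term by its projection \<open>\<pi>\<^sub>i f\<close>.  The Cauchy--Schwarz inequality, once in the space and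
  once for the weighted sum, gives
  \<open>\<parallel>g\<parallel>\<^sup>4 \<le> (\<Sum>\<omega>\<^sub>i\<^sup>2 \<parallel>\<theta>\<^sub>i g\<parallel>\<^sup>2) (\<Sum>\<omega>\<^sub>i\<^sup>2 \<parallel>\<pi>\<^sub>i f\<parallel>\<^sup>2) \<le> B \<parallel>g\<parallel>\<^sup>2 (\<Sum>\<omega>\<^sub>i\<^sup>2 \<parallel>\<pi>\<^sub>i f\<parallel>\<^sup>2)\<close>,
  so \<open>1 / B\<close> is a lower frame bound.

  The argument relies on \<^term>\<open>orth_proj\<close> and \<^term>\<open>hilbert_adjoint\<close> having their characteristic
  properties, that is, on the projection theorem (\<open>orth_proj_exists\<close>) and on the Riesz
  representation theorem (\<open>riesz_representation\<close>).  Completeness enters through the existence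
  of a nearest point in a closed subspace (\<open>nearest_point_exists\<close>).
\<close>

section \<open>Conjugation of scalars\<close>

lemma sconj_0: "sconj (0 :: 'k::real_or_complex) = 0"
  using sconj_add[of "0::'k" 0] by simp

lemma sconj_minus: "sconj (- x :: 'k::real_or_complex) = - sconj x"
  using sconj_add[of x "- x"] by (simp add: sconj_0 eq_neg_iff_add_eq_0 add.commute)

lemma sconj_diff: "sconj (x - y :: 'k::real_or_complex) = sconj x - sconj y"
  using sconj_add[of x "- y"] by (simp add: sconj_minus)

lemma mult_sconj_of_real: "(x :: 'k::real_or_complex) * sconj x = of_real ((norm x)\<^sup>2)"
  by (simp add: mult_sconj of_real_def)

section \<open>Geometry of the inner product\<close>

context hilbert_space
begin

lemma ip_add_right: "ip x (y + z) = ip x y + ip x z"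
  by (metis ip_add_left ip_commute sconj_add)

lemma ip_smul_right: "ip x (smul c y) = sconj c * ip x y"
  by (metis ip_smul_left ip_commute sconj_mult)

lemma ip_minus_left: "ip (- x) y = - ip x y"
  using ip_add_left[of x "- x" y] ip_add_left[of 0 0 y] by (simp add: eq_neg_iff_add_eq_0 add.commute)

lemma ip_diff_left: "ip (x - y) z = ip x z - ip y z"
  using ip_add_left[of x "- y" z] by (simp add: ip_minus_left)

lemma ip_diff_right: "ip x (y - z) = ip x y - ip x z"
  by (metis ip_diff_left ip_commute sconj_diff)

lemma ip_eq_0_commute: "ip x y = 0 \<Longrightarrow> ip y x = 0"
  by (metis ip_commute sconj_0)

lemma eq_if_ip_eq:
  assumes "\<And>x. ip x y = ip x z"
  shows "y = z"
proof -
  have "ip (y - z) (y - z) = 0"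
    by (simp add: assms ip_diff_right)
  then show ?thesis
    by (simp add: ip_self)
qed

lemma parallelogram_law:
  fixes x y :: 'a
  shows "(norm (x + y))\<^sup>2 + (norm (x - y))\<^sup>2 = 2 * (norm x)\<^sup>2 + 2 * (norm y)\<^sup>2"
proof -
  have "ip (x + y) (x + y) + ip (x - y) (x - y) = 2 * ip x x + 2 * ip y y"
    by (simp add: ip_add_left ip_add_right ip_diff_left ip_diff_right algebra_simps)
  then have "(of_real ((norm (x + y))\<^sup>2 + (norm (x - y))\<^sup>2) :: 'k)
      = of_real (2 * (norm x)\<^sup>2 + 2 * (norm y)\<^sup>2)"
    by (simp add: ip_self)
  then show ?thesis
    by (simp only: of_real_eq_iff)
qed

text \<open>
  Pythagoras for the projection of \<open>x\<close> onto the line through \<open>y\<close>.  Nonnegativity of the left-hand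
  side is the Cauchy--Schwarz inequality; conversely, the strict decrease of the norm when
  \<open>ip x y \<noteq> 0\<close> shows that a nearest point leaves an orthogonal remainder.
\<close>

lemma norm_line_remainder:
  fixes x y :: 'a
  assumes "y \<noteq> 0"
  defines "c \<equiv> ip x y / of_real ((norm y)\<^sup>2)"
  shows "(norm (x - smul c y))\<^sup>2 = (norm x)\<^sup>2 - (norm (ip x y))\<^sup>2 / (norm y)\<^sup>2"
proof -
  let ?r = "x - smul c y"
  have orth: "ip ?r y = 0"
    using assms by (simp add: ip_diff_left ip_smul_left ip_self)
  have "ip ?r ?r = ip x x - c * ip y x"
    by (simp add: ip_diff_right[of ?r] ip_smul_right orth) (simp add: ip_diff_left ip_smul_left)
  also have "c * ip y x = of_real ((norm (ip x y))\<^sup>2 / (norm y)\<^sup>2)"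
    unfolding c_def ip_commute[of y x] using mult_sconj_of_real[of "ip x y"] by simp
  finally have "(of_real ((norm ?r)\<^sup>2) :: 'k)
      = of_real ((norm x)\<^sup>2 - (norm (ip x y))\<^sup>2 / (norm y)\<^sup>2)"
    by (simp add: ip_self)
  then show ?thesis
    by (simp only: of_real_eq_iff)
qed

lemma norm_ip_le: "norm (ip x y) \<le> norm x * norm y"
proof (cases "y = 0")
  case True
  then show ?thesis
    using ip_diff_right[of x 0 0] by simp
next
  case False
  have "0 \<le> (norm x)\<^sup>2 - (norm (ip x y))\<^sup>2 / (norm y)\<^sup>2"
    using norm_line_remainder[OF False, of x] by (metis zero_le_power2)
  then have "(norm (ip x y))\<^sup>2 \<le> (norm x * norm y)\<^sup>2"
    using False by (simp add: field_simps power_mult_distrib)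
  then show ?thesis
    by (rule power2_le_imp_le) simp
qed

lemma bounded_linear_ip_left: "bounded_linear (\<lambda>x. ip x y)"
proof (rule bounded_linear_intro)
  show "ip (a + b) y = ip a y + ip b y" for a b
    by (rule ip_add_left)
  show "ip (r *\<^sub>R a) y = r *\<^sub>R ip a y" for r a
    by (simp add: smul_of_real[symmetric] ip_smul_left scaleR_conv_of_real)
  show "norm (ip a y) \<le> norm a * norm y" for a
    by (rule norm_ip_le)
qed

section \<open>The projection theorem\<close>

lemma closed_subspaceD:
  assumes "closed_subspace smul V"
  shows "closed V" "0 \<in> V" "\<And>x y. x \<in> V \<Longrightarrow> y \<in> V \<Longrightarrow> x + y \<in> V"
    "\<And>x y. x \<in> V \<Longrightarrow> y \<in> V \<Longrightarrow> x - y \<in> V" "\<And>c x. x \<in> V \<Longrightarrow> smul c x \<in> V"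
  using assms
  by (auto simp: closed_subspace_def intro: subspace_0 subspace_add subspace_diff subspace_scale)

text \<open>
  By the parallelogram law, the near-minimizers of the distance to \<open>f\<close> form closed sets whose
  diameters tend to \<open>0\<close>; Cantor's intersection theorem then provides a minimizer.
\<close>

lemma nearest_point_exists:
  assumes V: "closed_subspace smul V"
  shows "\<exists>p\<in>V. \<forall>v\<in>V. (norm (f - p))\<^sup>2 \<le> (norm (f - v))\<^sup>2"
proof -
  note V = closed_subspaceD[OF V]
  define D where "D = (\<lambda>v. (norm (f - v))\<^sup>2) ` V"
  define S where "S n = V \<inter> {v. (norm (f - v))\<^sup>2 \<le> Inf D + 1 / real (Suc n)}" for n
  have D_ne: "D \<noteq> {}"
    using V(2) by (auto simp: D_def)
  have lower: "Inf D \<le> (norm (f - v))\<^sup>2" if "v \<in> V" for v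
    using that by (auto simp: D_def intro!: cInf_lower bdd_belowI[of _ 0])
  have diam: "(norm (u - v))\<^sup>2 \<le> 4 / real (Suc n)" if "u \<in> S n" "v \<in> S n" for u v n
  proof -
    \<comment> \<open>The midpoint of two near-minimizers is again at distance at least the infimum.\<close>
    have "smul (of_real (1/2)) (u + v) \<in> V"
      using that V by (simp add: S_def)
    then have "Inf D \<le> (norm (f - (1/2) *\<^sub>R (u + v)))\<^sup>2"
      using lower unfolding smul_of_real by blast
    moreover have "(f - u) + (f - v) = 2 *\<^sub>R (f - (1/2) *\<^sub>R (u + v))"
      by (simp add: scaleR_right_diff_distrib scaleR_2)
    then have "(norm ((f - u) + (f - v)))\<^sup>2 = 4 * (norm (f - (1/2) *\<^sub>R (u + v)))\<^sup>2"
      by (simp only: norm_scaleR power_mult_distrib) simp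
    moreover have "(norm ((f - u) - (f - v)))\<^sup>2 = (norm (u - v))\<^sup>2"
      by (simp add: norm_minus_commute)
    moreover have "(norm (f - u))\<^sup>2 \<le> Inf D + 1 / real (Suc n)"
      "(norm (f - v))\<^sup>2 \<le> Inf D + 1 / real (Suc n)"
      using that by (auto simp: S_def)
    ultimately have "(norm (u - v))\<^sup>2 \<le> 4 * (1 / real (Suc n))"
      using parallelogram_law[of "f - u" "f - v"] by linarith
    then show ?thesis
      by simp
  qed
  have "\<exists>p. \<forall>n. p \<in> S n"
  proof (rule decreasing_closed_nest)
    fix n
    show "closed (S n)"
      unfolding S_def by (intro closed_Int V(1) closed_Collect_le continuous_intros)
    show "S n \<noteq> {}"
      using cInf_lessD[OF D_ne, of "Inf D + 1 / real (Suc n)"] by (force simp: S_def D_def)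
  next
    fix m n :: nat
    assume "m \<le> n"
    then have "1 / real (Suc n) \<le> 1 / real (Suc m)"
      by (simp add: frac_le)
    then show "S n \<subseteq> S m"
      by (auto simp: S_def)
  next
    fix e :: real
    assume "0 < e"
    then obtain n where n: "inverse (real (Suc n)) < e\<^sup>2 / 4"
      using reals_Archimedean[of "e\<^sup>2 / 4"] by auto
    have "dist u v < e" if "u \<in> S n" "v \<in> S n" for u v
    proof -
      have "(dist u v)\<^sup>2 < e\<^sup>2"
        using diam[OF that] n by (simp add: dist_norm inverse_eq_divide)
      then show ?thesis
        using \<open>0 < e\<close> by (simp add: power2_less_imp_less)
    qed
    then show "\<exists>n. \<forall>x\<in>S n. \<forall>y\<in>S n. dist x y < e"
      by blast
  qed blast
  then obtain p where p: "\<And>n. p \<in> S n"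
    by blast
  have "(norm (f - p))\<^sup>2 \<le> Inf D"
  proof (rule field_le_epsilon)
    fix e :: real
    assume "0 < e"
    then obtain n where "inverse (real (Suc n)) < e"
      using reals_Archimedean by blast
    with p[of n] show "(norm (f - p))\<^sup>2 \<le> Inf D + e"
      by (simp add: S_def inverse_eq_divide)
  qed
  then have "\<forall>v\<in>V. (norm (f - p))\<^sup>2 \<le> (norm (f - v))\<^sup>2"
    using lower by (blast intro: order_trans)
  moreover have "p \<in> V"
    using p[of 0] by (simp add: S_def)
  ultimately show ?thesis
    by blast
qed

lemma orth_proj_exists:
  assumes V: "closed_subspace smul V"
  shows "\<exists>p\<in>V. \<forall>v\<in>V. ip (f - p) v = 0"
proof -
  obtain p where p: "p \<in> V" "\<And>v. v \<in> V \<Longrightarrow> (norm (f - p))\<^sup>2 \<le> (norm (f - v))\<^sup>2"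
    using nearest_point_exists[OF V] by blast
  have "ip (f - p) v = 0" if v: "v \<in> V" for v
  proof (cases "v = 0")
    case True
    then show ?thesis
      using ip_diff_right[of "f - p" 0 0] by simp
  next
    case False
    let ?c = "ip (f - p) v / of_real ((norm v)\<^sup>2)"
    have "p + smul ?c v \<in> V"
      by (intro closed_subspaceD[OF V] p v)
    from p(2)[OF this] have "(norm (f - p))\<^sup>2 \<le> (norm (f - p - smul ?c v))\<^sup>2"
      by (simp add: diff_diff_eq)
    then have "(norm (ip (f - p) v))\<^sup>2 / (norm v)\<^sup>2 \<le> 0"
      unfolding norm_line_remainder[OF False] by linarith
    then show ?thesis
      using False by (simp add: divide_le_0_iff)
  qed
  with p(1) show ?thesis
    by blast
qed

lemma orth_proj_characterization:
  assumes V: "closed_subspace smul V"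
  shows "orth_proj ip V f \<in> V \<and> (\<forall>v\<in>V. ip (f - orth_proj ip V f) v = 0)"
  unfolding orth_proj_def
proof (rule theI')
  show "\<exists>!p. p \<in> V \<and> (\<forall>v\<in>V. ip (f - p) v = 0)"
  proof (rule ex_ex1I)
    show "\<exists>p. p \<in> V \<and> (\<forall>v\<in>V. ip (f - p) v = 0)"
      using orth_proj_exists[OF V] by blast
  next
    fix p q
    assume p: "p \<in> V \<and> (\<forall>v\<in>V. ip (f - p) v = 0)" and q: "q \<in> V \<and> (\<forall>v\<in>V. ip (f - q) v = 0)"
    then have "p - q \<in> V"
      using closed_subspaceD[OF V] by blast
    with p q have "ip (f - p) (p - q) = 0" "ip (f - q) (p - q) = 0"
      by blast+
    then have "ip ((f - q) - (f - p)) (p - q) = 0"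
      by (simp only: ip_diff_left[of "f - q"] diff_self)
    then have "ip (p - q) (p - q) = 0"
      by simp
    then show "p = q"
      by (simp add: ip_self)
  qed
qed

lemma ip_orth_proj:
  assumes "closed_subspace smul V" "v \<in> V"
  shows "ip v (orth_proj ip V f) = ip v f"
proof -
  have "ip v (f - orth_proj ip V f) = 0"
    using orth_proj_characterization[OF assms(1)] assms(2) ip_eq_0_commute by blast
  then show ?thesis
    by (simp add: ip_diff_right)
qed

section \<open>The adjoint operator\<close>

text \<open>
  A vector \<open>u\<close> orthogonal to the kernel of \<open>\<phi>\<close> represents \<open>\<phi>\<close> up to a scalar, because
  \<open>\<phi>(u) x - \<phi>(x) u\<close> lies in the kernel for every \<open>x\<close>.
\<close>

lemma riesz_representation:
  assumes bl: "bounded_linear \<phi>" and scale: "\<And>c x. \<phi> (smul c x) = c * \<phi> x"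
  shows "\<exists>z. \<forall>x. \<phi> x = ip x z"
proof (cases "\<forall>x. \<phi> x = 0")
  case True
  have "ip x 0 = 0" for x
    using ip_diff_right[of x 0 0] by simp
  with True show ?thesis
    by auto
next
  case False
  then obtain f where f: "\<phi> f \<noteq> 0"
    by blast
  interpret \<phi>: bounded_linear \<phi>
    by (rule bl)
  have "subspace {x. \<phi> x = 0}"
    by (rule subspaceI) (auto simp: \<phi>.add scale \<phi>.zero)
  moreover have "closed {x. \<phi> x = 0}"
    by (intro closed_Collect_eq linear_continuous_on bl continuous_on_const)
  ultimately have "closed_subspace smul {x. \<phi> x = 0}"
    by (simp add: closed_subspace_def)
  from orth_proj_exists[OF this, of f]
  obtain p where p: "\<phi> p = 0" "\<And>v. \<phi> v = 0 \<Longrightarrow> ip (f - p) v = 0"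
    by auto
  define u where "u = f - p"
  have u: "\<phi> u \<noteq> 0" "\<And>v. \<phi> v = 0 \<Longrightarrow> ip v u = 0"
    using f p ip_eq_0_commute by (auto simp: u_def \<phi>.diff)
  then have "u \<noteq> 0"
    using \<phi>.zero by auto
  define z where "z = smul (sconj (\<phi> u / of_real ((norm u)\<^sup>2))) u"
  have "\<phi> x = ip x z" for x
  proof -
    have "ip (smul (\<phi> u) x - smul (\<phi> x) u) u = 0"
      by (intro u) (simp add: \<phi>.diff scale)
    then show ?thesis
      using \<open>u \<noteq> 0\<close>
      by (simp add: z_def ip_smul_right sconj_sconj ip_diff_left ip_smul_left ip_self)
  qed
  then show ?thesis
    by blast
qed

lemma ip_hilbert_adjoint:
  assumes T: "bounded_operator smul T"
  shows "ip x (hilbert_adjoint ip T y) = ip (T x) y"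
proof -
  have "\<exists>z. \<forall>x. ip (T x) y = ip x z" for y
  proof (rule riesz_representation)
    show "bounded_linear (\<lambda>x. ip (T x) y)"
      using T unfolding bounded_operator_def
      by (intro bounded_linear_compose[OF bounded_linear_ip_left]) blast
    show "ip (T (smul c x)) y = c * ip (T x) y" for c x
      using T by (simp add: bounded_operator_def ip_smul_left)
  qed
  then obtain T' where T': "\<And>x y. ip (T x) y = ip x (T' y)"
    by metis
  have "\<exists>!T'. \<forall>x y. ip (T x) y = ip x (T' y)"
  proof (rule ex1I)
    show "\<forall>x y. ip (T x) y = ip x (T' y)"
      using T' by blast
    show "S = T'" if "\<forall>x y. ip (T x) y = ip x (S y)" for S
      using that T' by (intro ext eq_if_ip_eq) metis
  qed
  from theI'[OF this] show ?thesis
    unfolding hilbert_adjoint_def by metis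
qed

section \<open>The lower frame bound\<close>

text \<open>
  The bound is obtained for finite partial sums first, where the Cauchy--Schwarz inequality for sums
  applies to the factors \<open>\<omega>\<^sub>i \<parallel>\<theta>\<^sub>i g\<parallel>\<close> and \<open>\<omega>\<^sub>i \<parallel>\<pi>\<^sub>i f\<parallel>\<close>, and then passes to the limit by continuity of the
  inner product.
\<close>

lemma norm_ip_weighted_sum_le:
  assumes V: "\<And>i. i \<in> I \<Longrightarrow> closed_subspace smul (V i)"
    and x: "\<And>i. i \<in> I \<Longrightarrow> x i \<in> V i"
    and s: "((\<lambda>i. (\<omega> i)\<^sup>2 *\<^sub>R x i) has_sum s) I"
    and x_sum: "(\<lambda>i. (\<omega> i)\<^sup>2 * (norm (x i))\<^sup>2) summable_on I"
    and f_sum: "(\<lambda>i. (\<omega> i)\<^sup>2 * (norm (orth_proj ip (V i) f))\<^sup>2) summable_on I"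
  shows "(norm (ip s f))\<^sup>2 \<le> (\<Sum>\<^sub>\<infinity>i\<in>I. (\<omega> i)\<^sup>2 * (norm (x i))\<^sup>2)
    * (\<Sum>\<^sub>\<infinity>i\<in>I. (\<omega> i)\<^sup>2 * (norm (orth_proj ip (V i) f))\<^sup>2)" (is "_ \<le> ?X * ?P")
proof -
  interpret L: bounded_linear "\<lambda>x. ip x f"
    by (rule bounded_linear_ip_left)
  let ?p = "\<lambda>i. orth_proj ip (V i) f"
  have partial: "(norm (ip (\<Sum>i\<in>F. (\<omega> i)\<^sup>2 *\<^sub>R x i) f))\<^sup>2 \<le> ?X * ?P"
    if F: "finite F" "F \<subseteq> I" for F
  proof -
    have "norm (ip (\<Sum>i\<in>F. (\<omega> i)\<^sup>2 *\<^sub>R x i) f) \<le> (\<Sum>i\<in>F. norm (ip ((\<omega> i)\<^sup>2 *\<^sub>R x i) f))"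
      unfolding L.sum by (rule norm_sum)
    also have "\<dots> \<le> (\<Sum>i\<in>F. (\<bar>\<omega> i\<bar> * norm (x i)) * (\<bar>\<omega> i\<bar> * norm (?p i)))"
    proof (rule sum_mono)
      fix i
      assume "i \<in> F"
      then have i: "i \<in> I"
        using F by blast
      have "norm (ip ((\<omega> i)\<^sup>2 *\<^sub>R x i) f) = (\<omega> i)\<^sup>2 * norm (ip (x i) (?p i))"
        by (simp add: L.scaleR ip_orth_proj[OF V[OF i] x[OF i]])
      also have "\<dots> \<le> (\<omega> i)\<^sup>2 * (norm (x i) * norm (?p i))"
        by (intro mult_left_mono norm_ip_le) simp
      also have "\<dots> = (\<bar>\<omega> i\<bar> * norm (x i)) * (\<bar>\<omega> i\<bar> * norm (?p i))"
        by (simp add: power2_eq_square algebra_simps flip: abs_mult)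
      finally show "norm (ip ((\<omega> i)\<^sup>2 *\<^sub>R x i) f) \<le> \<dots>" .
    qed
    finally have "(norm (ip (\<Sum>i\<in>F. (\<omega> i)\<^sup>2 *\<^sub>R x i) f))\<^sup>2
        \<le> (\<Sum>i\<in>F. (\<bar>\<omega> i\<bar> * norm (x i)) * (\<bar>\<omega> i\<bar> * norm (?p i)))\<^sup>2"
      by (rule power_mono) simp
    also have "\<dots> \<le> (\<Sum>i\<in>F. (\<bar>\<omega> i\<bar> * norm (x i))\<^sup>2) * (\<Sum>i\<in>F. (\<bar>\<omega> i\<bar> * norm (?p i))\<^sup>2)"
      by (rule Cauchy_Schwarz_ineq_sum)
    also have "\<dots> = (\<Sum>i\<in>F. (\<omega> i)\<^sup>2 * (norm (x i))\<^sup>2) * (\<Sum>i\<in>F. (\<omega> i)\<^sup>2 * (norm (?p i))\<^sup>2)"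
      by (simp add: power_mult_distrib)
    also have "\<dots> \<le> ?X * ?P"
      using F x_sum f_sum
      by (intro mult_mono finite_sum_le_infsum sum_nonneg infsum_nonneg) auto
    finally show ?thesis .
  qed
  have "((\<lambda>F. (norm (ip (\<Sum>i\<in>F. (\<omega> i)\<^sup>2 *\<^sub>R x i) f))\<^sup>2) \<longlongrightarrow> (norm (ip s f))\<^sup>2)
      (finite_subsets_at_top I)"
    using s unfolding has_sum_def by (intro tendsto_intros L.tendsto)
  then show ?thesis
    by (rule tendsto_upperbound) (auto intro: eventually_finite_subsets_at_top_weakI partial)
qed

lemma K_fusion_frame_if_l2_resolution:
  assumes K: "bounded_operator smul K"
    and res: "l2_resolution smul I K \<theta> \<omega>"
    and bessel: "bessel_fusion_sequence smul ip I V \<omega>"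
    and range: "\<And>i. i \<in> I \<Longrightarrow> range (\<theta> i) \<subseteq> V i"
  shows "K_fusion_frame smul ip I K V \<omega>"
proof -
  obtain B where B: "B > 0"
    and sum_K: "\<And>f. ((\<lambda>i. (\<omega> i)\<^sup>2 *\<^sub>R \<theta> i f) has_sum K f) I"
    and \<theta>_sum: "\<And>f. (\<lambda>i. (\<omega> i)\<^sup>2 * (norm (\<theta> i f))\<^sup>2) summable_on I"
    and \<theta>_le: "\<And>f. (\<Sum>\<^sub>\<infinity>i\<in>I. (\<omega> i)\<^sup>2 * (norm (\<theta> i f))\<^sup>2) \<le> B * (norm f)\<^sup>2"
    using res unfolding l2_resolution_def by blast
  have V: "\<And>i. i \<in> I \<Longrightarrow> closed_subspace smul (V i)"
    and P_sum: "\<And>f. (\<lambda>i. (\<omega> i)\<^sup>2 * (norm (orth_proj ip (V i) f))\<^sup>2) summable_on I"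
    using bessel unfolding bessel_fusion_sequence_def by blast+
  have "1 / B * (norm (hilbert_adjoint ip K f))\<^sup>2
      \<le> (\<Sum>\<^sub>\<infinity>i\<in>I. (\<omega> i)\<^sup>2 * (norm (orth_proj ip (V i) f))\<^sup>2)" (is "_ \<le> ?P") for f
  proof -
    define g where "g = hilbert_adjoint ip K f"
    have P_nonneg: "?P \<ge> 0"
      by (intro infsum_nonneg) simp
    have "ip (K g) f = of_real ((norm g)\<^sup>2)"
      using ip_hilbert_adjoint[OF K, of g f] by (simp add: g_def ip_self)
    then have "(norm g)\<^sup>2 * (norm g)\<^sup>2 = (norm (ip (K g) f))\<^sup>2"
      by (simp add: power2_eq_square norm_mult)
    also have "\<dots> \<le> (\<Sum>\<^sub>\<infinity>i\<in>I. (\<omega> i)\<^sup>2 * (norm (\<theta> i g))\<^sup>2) * ?P"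
      using range by (intro norm_ip_weighted_sum_le V sum_K \<theta>_sum P_sum) auto
    also have "\<dots> \<le> (B * (norm g)\<^sup>2) * ?P"
      by (intro mult_right_mono \<theta>_le P_nonneg)
    finally have "(norm g)\<^sup>2 * (norm g)\<^sup>2 \<le> (norm g)\<^sup>2 * (B * ?P)"
      by (simp only: mult.assoc mult.left_commute)
    then have "(norm g)\<^sup>2 \<le> B * ?P"
      using B P_nonneg by (cases "g = 0") (simp, erule mult_left_le_imp_le, simp)
    then show ?thesis
      using B by (simp add: g_def field_simps)
  qed
  moreover have "1 / B > 0"
    using B by simp
  ultimately show ?thesis
    using bessel unfolding K_fusion_frame_def by blast
qed

end

theorem proposition4p2:
  fixes smul :: "'k::real_or_complex \<Rightarrow> 'a::banach \<Rightarrow> 'a"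
    and ip :: "'a \<Rightarrow> 'a \<Rightarrow> 'k"
    and I :: "'i set"
    and K :: "'a \<Rightarrow> 'a"
    and \<theta> :: "'i \<Rightarrow> 'a \<Rightarrow> 'a"
    and \<omega> :: "'i \<Rightarrow> real"
  assumes "hilbert_space smul ip"
    and "separable_space (euclidean :: 'a topology)"
    and "countable I"
    and "bounded_operator smul K"
    and "l2_resolution smul I K \<theta> \<omega>"
    and "bessel_fusion_sequence smul ip I (\<lambda>i. closure (range (\<theta> i))) \<omega>"
  shows "K_fusion_frame smul ip I K (\<lambda>i. closure (range (\<theta> i))) \<omega>"
  using assms(1,4-6) closure_subset by (rule hilbert_space.K_fusion_frame_if_l2_resolution)

end
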